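(* Let $(\mathfrak{A},\Phi)$ be a $C^*$-dynamical system which is uniquely ergodic with respect to the fixed-point subalgebra. Let $\lambda\in\sigma^{\mathrm{ph}}_{\mathrm{pp}}(\Phi)$ and suppose that $\mathfrak{A}_\lambda$ contains an isometry or a co-isometry $u$. Then the formulas (i) $E_\lambda(x):=E_1(xu^* )u$, $x\in\mathfrak{A}$ (if $u\in\mathfrak{A}_\lambda$ is an isometry), (ii) $E_\lambda(x):=uE_1(u^*x)$, $x\in\mathfrak{A}$ (if $u\in\mathfrak{A}_\lambda$ is a co-isometry), uniquely define a norm-one projection $E_\lambda:\mathfrak{A}\to\mathfrak{A}_\lambda$ onto $\mathfrak{A}_\lambda$, which is independent of the choice of $u$ among the isometries and co-isometries of $\mathfrak{A}_\lambda$. In addition, for each $x\in\mathfrak{A}$, $$\lim_{n\to+\infty}\bigg(\frac1{n}\sum_{k=0}^{n-1}\lambda^{-k}\Phi^k(x)\bigg)=E_\lambda(x)$$ in the norm topology.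
   Context: $\mathbb{T}=\{\lambda\in\mathbb{C}\mid|\lambda|=1\}$. A $C^*$-dynamical system $(\mathfrak{A},\Phi)$ means a unital $C^*$-algebra $\mathfrak{A}\neq\{0\}$ with unit $1$, together with a unital $*$-homomorphism $\Phi:\mathfrak{A}\to\mathfrak{A}$. An element $u\in\mathfrak{A}$ is an isometry if $u^*u=1$ and a co-isometry if $uu^*=1$. For $\lambda\in\mathbb{T}$, $\mathfrak{A}_\lambda:=\{a\in\mathfrak{A}\mid\Phi(a)=\lambda a\}$, and $\sigma^{\mathrm{ph}}_{\mathrm{pp}}(\Phi):=\{\lambda\in\mathbb{T}\mid\lambda\text{ is an eigenvalue of }\Phi\}$. The fixed-point subalgebra is $\mathfrak{A}^\Phi=\mathfrak{A}_1$. $(\mathfrak{A},\Phi)$ is uniquely ergodic with respect to the fixed-point subalgebra if for every $a\in\mathfrak{A}$ the averages $\frac1n\sum_{k=0}^{n-1}\Phi^k(a)$ converge in norm as $n\to+\infty$; the limit is denoted $E_1(a)$, and $E_1:\mathfrak{A}\to\mathfrak{A}^\Phi$ is then necessarily a $\Phi$-invariant conditional expectation onto $\mathfrak{A}^\Phi$. A norm-one projection onto $\mathfrak{A}_\lambda$ is a linear map $E:\mathfrak{A}\to\mathfrak{A}$ with range $\mathfrak{A}_\lambda$, $E\circ E=E$ and $\|E\|=1$. *)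

theory Defs
  imports "HOL-Analysis.Analysis"
begin

text \<open>
  The C*-algebra is the whole type. The real structure required by the library classes is the
  restriction of the complex one (\<open>scaleR_scaleC\<close>). The parent class \<open>real_normed_algebra_1\<close>
  contributes \<open>0 \<noteq> 1\<close>, submultiplicativity of the norm and \<open>norm 1 = 1\<close>; the last is no restriction,
  as it follows from the C*-identity in a nonzero unital algebra.
\<close>

class unital_cstar_algebra = real_normed_algebra_1 + banach +
  fixes scaleC :: "complex \<Rightarrow> 'a \<Rightarrow> 'a"  (infixr \<open>*\<^sub>C\<close> 75)
    and star :: "'a \<Rightarrow> 'a"
  assumes scaleC_add_right: "c *\<^sub>C (x + y) = c *\<^sub>C x + c *\<^sub>C y"
    and scaleC_add_left: "(c + d) *\<^sub>C x = c *\<^sub>C x + d *\<^sub>C x"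
    and scaleC_scaleC: "c *\<^sub>C d *\<^sub>C x = (c * d) *\<^sub>C x"
    and scaleC_one: "1 *\<^sub>C x = x"
    and scaleR_scaleC: "r *\<^sub>R x = complex_of_real r *\<^sub>C x"
    and mult_scaleC_left: "(c *\<^sub>C x) * y = c *\<^sub>C (x * y)"
    and mult_scaleC_right: "x * (c *\<^sub>C y) = c *\<^sub>C (x * y)"
    and norm_scaleC: "norm (c *\<^sub>C x) = cmod c * norm x"
    and star_star: "star (star x) = x"
    and star_add: "star (x + y) = star x + star y"
    and star_scaleC: "star (c *\<^sub>C x) = cnj c *\<^sub>C star x"
    and star_mult: "star (x * y) = star y * star x"
    and cstar_identity: "norm (star x * x) = (norm x)\<^sup>2"

definition isometry :: "'a::unital_cstar_algebra \<Rightarrow> bool" where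
  "isometry u \<longleftrightarrow> star u * u = 1"

definition co_isometry :: "'a::unital_cstar_algebra \<Rightarrow> bool" where
  "co_isometry u \<longleftrightarrow> u * star u = 1"

definition unital_star_hom :: "('a::unital_cstar_algebra \<Rightarrow> 'b::unital_cstar_algebra) \<Rightarrow> bool" where
  "unital_star_hom \<Phi> \<longleftrightarrow>
     Vector_Spaces.linear scaleC scaleC \<Phi> \<and>
     (\<forall>x y. \<Phi> (x * y) = \<Phi> x * \<Phi> y) \<and>
     (\<forall>x. \<Phi> (star x) = star (\<Phi> x)) \<and>
     \<Phi> 1 = 1"

definition eigenspace :: "('a::unital_cstar_algebra \<Rightarrow> 'a) \<Rightarrow> complex \<Rightarrow> 'a set" where
  "eigenspace \<Phi> \<mu> = {a. \<Phi> a = \<mu> *\<^sub>C a}"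

definition peripheral_point_spectrum :: "('a::unital_cstar_algebra \<Rightarrow> 'a) \<Rightarrow> complex set" where
  "peripheral_point_spectrum \<Phi> = {\<mu>. cmod \<mu> = 1 \<and> (\<exists>a. a \<noteq> 0 \<and> \<Phi> a = \<mu> *\<^sub>C a)}"

definition ergodic_average :: "('a::unital_cstar_algebra \<Rightarrow> 'a) \<Rightarrow> nat \<Rightarrow> 'a \<Rightarrow> 'a" where
  "ergodic_average \<Phi> n a = (1 / real n) *\<^sub>R (\<Sum>k<n. (\<Phi> ^^ k) a)"

definition uniquely_ergodic_fixed :: "('a::unital_cstar_algebra \<Rightarrow> 'a) \<Rightarrow> bool" where
  "uniquely_ergodic_fixed \<Phi> \<longleftrightarrow> (\<forall>a. convergent (\<lambda>n. ergodic_average \<Phi> n a))"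

text \<open>Meaningful only under \<open>uniquely_ergodic_fixed\<close>, since \<open>lim\<close> is total.\<close>

definition E1 :: "('a::unital_cstar_algebra \<Rightarrow> 'a) \<Rightarrow> 'a \<Rightarrow> 'a" where
  "E1 \<Phi> a = lim (\<lambda>n. ergodic_average \<Phi> n a)"

text \<open>
  The library's \<open>onorm\<close> is the operator norm only for bounded maps, so boundedness is required
  separately; complex linearity is not implied by \<open>bounded_linear\<close>, which is over the reals.
\<close>

definition norm_one_projection_onto ::
    "'a::unital_cstar_algebra set \<Rightarrow> ('a \<Rightarrow> 'a) \<Rightarrow> bool" where
  "norm_one_projection_onto S E \<longleftrightarrow>
     Vector_Spaces.linear scaleC scaleC E \<and> range E = S \<and> E \<circ> E = E \<and>
     bounded_linear E \<and> onorm E = 1"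

end

theory Submission
  imports Defs
begin

text \<open>
  Put \<open>\<Psi> x = cnj \<mu> *\<^sub>C \<Phi> x\<close>. The fixed points of \<open>\<Psi>\<close> are the eigenvectors of \<open>\<Phi>\<close> for \<open>\<mu>\<close>, and
  the averages weighted by \<open>\<mu> powi (- k)\<close> are the plain ergodic averages of \<open>\<Psi>\<close>. If \<open>u\<close> is an
  isometry with \<open>\<Phi> u = \<mu> *\<^sub>C u\<close>, then
  \<open>\<Phi>\<^sup>k (x * star u) * u = cnj \<mu> ^ k *\<^sub>C (\<Phi>\<^sup>k x * star u * u) = \<Psi>\<^sup>k x\<close>,
  so the averages of \<open>\<Psi>\<close> at \<open>x\<close> are those of \<open>\<Phi>\<close> at \<open>x * star u\<close>, multiplied by \<open>u\<close>. Hence they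
  converge, and the limit is \<open>E1 \<Phi> (x * star u) * u\<close>; since the averages of \<open>\<Psi>\<close> do not involve
  \<open>u\<close>, neither does the limit. Co-isometries are treated in the same way on the other side.

  It remains to see that the limit is a norm-one projection onto the fixed points of \<open>\<Psi>\<close>. This is
  the mean ergodic theorem for a linear contraction with convergent averages
  (\<open>norm_one_projection_onto_E1\<close>). The analytic input is that a *-homomorphism is a contraction
  (\<open>norm_star_hom_le\<close>). By the C*-identity it suffices to treat a self-adjoint \<open>h\<close> with
  \<open>norm h < 1\<close>. Such an \<open>h\<close> is the real part of the unitary \<open>h + \<i> s\<close>, where \<open>s\<close> is the square root of
  \<open>1 - h\<^sup>2\<close> given by the binomial series (\<open>obtain_unitary_real_part\<close>). A *-homomorphism maps
  unitaries to unitaries, which have norm 1, and therefore \<open>h\<close> to an element of norm at most 1.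
\<close>

section \<open>Elementary facts on C*-algebras\<close>

interpretation scaleC: vector_space "scaleC :: complex \<Rightarrow> 'a \<Rightarrow> 'a::unital_cstar_algebra"
  by unfold_locales (simp_all add: scaleC_add_right scaleC_add_left scaleC_scaleC scaleC_one)

lemma bounded_linear_scaleC: "bounded_linear (\<lambda>x::'a::unital_cstar_algebra. c *\<^sub>C x)"
  by (rule bounded_linear_intro[where K = "cmod c"])
    (simp_all add: scaleC_add_right scaleR_scaleC scaleC_scaleC norm_scaleC mult.commute)

lemma norm_star: "norm (star x) = norm (x::'a::unital_cstar_algebra)"
proof -
  have le: "norm y \<le> norm (star y)" for y :: 'a
  proof (cases "y = 0")
    case False
    have "norm y * norm y \<le> norm (star y) * norm y"
      using norm_mult_ineq[of "star y" y] by (simp add: cstar_identity power2_eq_square)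
    then show ?thesis using False by simp
  qed simp
  show ?thesis using le[of x] le[of "star x"] by (simp add: star_star)
qed

lemma star_scaleR: "star (r *\<^sub>R x) = r *\<^sub>R star (x::'a::unital_cstar_algebra)"
  by (simp add: scaleR_scaleC star_scaleC)

lemma bounded_linear_star: "bounded_linear (star :: 'a::unital_cstar_algebra \<Rightarrow> 'a)"
  by (rule bounded_linear_intro[where K = 1]) (simp_all add: star_add star_scaleR norm_star)

lemma star_one: "star 1 = (1::'a::unital_cstar_algebra)"
  by (metis mult_1_left mult_1_right star_mult star_star)

lemma star_power: "star (x ^ n) = star (x::'a::unital_cstar_algebra) ^ n"
  by (induction n) (simp_all add: star_one star_mult power_commutes)

lemma norm_isometry:
  assumes "isometry (u::'a::unital_cstar_algebra)"
  shows "norm u = 1"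
proof -
  have "(norm u)\<^sup>2 = 1"
    using assms cstar_identity[of u] by (simp add: isometry_def)
  then show ?thesis
    by (simp add: power2_eq_1_iff) (metis norm_ge_zero not_one_le_zero neg_0_le_iff_le)
qed

section \<open>Homomorphisms of C*-algebras are contractions\<close>

text \<open>
  The coefficients are those of the binomial series for \<open>sqrt (1 - t)\<close>. That the square of the
  series is \<open>1 - t\<close> is the Vandermonde identity for the exponents \<open>1/2 + 1/2 = 1\<close>.
\<close>
lemma sqrt_one_minus_series:
  fixes t :: "'a::{real_normed_algebra_1, banach}"
  assumes "norm t < 1"
  defines "f \<equiv> \<lambda>n. (((1/2) gchoose n) * (- 1) ^ n) *\<^sub>R t ^ n"
  shows "summable f" and "suminf f * suminf f = 1 - t"
proof -
  let ?c = "\<lambda>n. ((1/2) gchoose n) * (- 1) ^ n :: real"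
  obtain r where r: "norm t < r" "r < 1" using assms dense by blast
  have r0: "0 < r" using r(1) by (rule le_less_trans[OF norm_ge_zero])
  have "summable (\<lambda>n. ((1/2) gchoose n) * (- r) ^ n)"
    using gen_binomial_real[of "- r" "1/2"] r r0 by (auto dest: sums_summable)
  then have "summable (\<lambda>n. ?c n * r ^ n)"
    by (subst (asm) power_minus) (simp add: mult.assoc)
  then have "summable (\<lambda>n. norm (?c n * norm t ^ n))"
    by (rule powser_insidea) (use r r0 in auto)
  then have abs: "summable (\<lambda>n. norm (f n))"
    by (rule summable_comparison_test'[where N = 0])
      (auto simp: f_def abs_mult power_abs intro!: mult_left_mono norm_power_ineq)
  then show "summable f" by (rule summable_norm_cancel)
  have conv: "(\<Sum>i\<le>n. f i * f (n - i)) = (if n = 0 then 1 else if n = 1 then - t else 0)" for n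
  proof -
    have "(\<Sum>i\<le>n. f i * f (n - i)) = (\<Sum>i\<le>n. (?c i * ?c (n - i)) *\<^sub>R t ^ n)"
      by (rule sum.cong) (auto simp: f_def simp flip: power_add)
    also have "\<dots> = ((- 1) ^ n * (\<Sum>i\<le>n. ((1/2) gchoose i) * ((1/2) gchoose (n - i)))) *\<^sub>R t ^ n"
      unfolding scaleR_sum_left[symmetric] sum_distrib_left
      by (intro arg_cong[where f = "\<lambda>x. x *\<^sub>R t ^ n"] sum.cong) (auto simp flip: power_add)
    also have "(\<Sum>i\<le>n. ((1/2) gchoose i) * ((1/2) gchoose (n - i))) = ((1::real) gchoose n)"
      using gbinomial_Vandermonde[of "1/2::real" "1/2" n] by (simp add: atMost_atLeast0)
    also have "((1::real) gchoose n) = of_nat (1 choose n)"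
      by (metis binomial_gbinomial of_nat_1)
    finally show ?thesis
      by (auto simp: binomial_eq_0)
  qed
  have "(\<lambda>n. \<Sum>i\<le>n. f i * f (n - i)) sums (suminf f * suminf f)"
    by (rule Cauchy_product_sums[OF abs abs])
  moreover have "(\<lambda>n. \<Sum>i\<le>n. f i * f (n - i)) sums (1 - t)"
    unfolding conv
    using sums_finite[of "{0, 1}" "\<lambda>n. if n = 0 then 1 else if n = 1 then - t else (0::'a)"]
    by auto
  ultimately show "suminf f * suminf f = 1 - t" by (rule sums_unique2)
qed

text \<open>
  In the complex plane this is the point \<open>h + \<i> sqrt (1 - h\<^sup>2)\<close> of the unit circle above \<open>h\<close>. The
  square root is a power series in \<open>h\<close>, hence self-adjoint and commuting with \<open>h\<close>, and
  so \<open>star v * v\<close> has no mixed terms.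
\<close>
lemma obtain_unitary_real_part:
  fixes h :: "'a::unital_cstar_algebra"
  assumes sa: "star h = h" and "norm h < 1"
  obtains v where "isometry v" "h = (1/2) *\<^sub>R (v + star v)"
proof -
  define f where "f = (\<lambda>n. (((1/2) gchoose n) * (- 1) ^ n) *\<^sub>R (h * h) ^ n)"
  define s where "s = suminf f"
  have "norm (h * h) \<le> norm h * norm h" by (rule norm_mult_ineq)
  also have "\<dots> < 1" using mult_strict_mono'[of "norm h" 1 "norm h" 1] assms(2) by simp
  finally have lt: "norm (h * h) < 1" .
  have sm: "summable f" and ss: "s * s = 1 - h * h"
    using sqrt_one_minus_series[OF lt] by (simp_all add: f_def s_def)
  have "star (f n) = f n" for n
    by (simp add: f_def star_scaleR star_power star_mult sa)
  then have star_s: "star s = s"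
    using bounded_linear.suminf[OF bounded_linear_star sm] by (simp add: s_def)
  have "h * f n = f n * h" for n
    by (simp add: f_def) (metis mult.assoc power_commuting_commutes)
  then have comm: "h * s = s * h"
    using suminf_mult[OF sm, of h] suminf_mult2[OF sm, of h] by (simp add: s_def)
  define v where "v = h + \<i> *\<^sub>C s"
  have star_v: "star v = h + (- \<i>) *\<^sub>C s"
    by (simp add: v_def star_add star_scaleC sa star_s)
  have sq: "(\<i> *\<^sub>C s) * (\<i> *\<^sub>C s) = - (s * s)"
    by (simp add: mult_scaleC_left mult_scaleC_right scaleC_scaleC scaleC_one)
  have hs: "h * (\<i> *\<^sub>C s) = (\<i> *\<^sub>C s) * h"
    by (simp only: mult_scaleC_left mult_scaleC_right comm)
  have "star v = h - \<i> *\<^sub>C s"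
    by (simp add: star_v)
  then have "star v * v = h * h + s * s"
    by (simp add: v_def distrib_left left_diff_distrib sq hs)
  then have "isometry v" by (simp add: ss isometry_def)
  moreover have "h = (1/2) *\<^sub>R (v + star v)"
    unfolding star_v unfolding v_def by (simp flip: scaleR_add_left)
  ultimately show thesis by (rule that)
qed

lemma unital_star_homD:
  assumes "unital_star_hom \<Phi>"
  shows "\<Phi> (x + y) = \<Phi> x + \<Phi> y" "\<Phi> (c *\<^sub>C x) = c *\<^sub>C \<Phi> x" "\<Phi> (r *\<^sub>R x) = r *\<^sub>R \<Phi> x"
    "\<Phi> (x * y) = \<Phi> x * \<Phi> y" "\<Phi> (star x) = star (\<Phi> x)" "\<Phi> 1 = 1"
  using assms by (auto simp: unital_star_hom_def Vector_Spaces.linear_iff scaleR_scaleC)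

lemma norm_star_hom_le:
  fixes \<Phi> :: "'a::unital_cstar_algebra \<Rightarrow> 'b::unital_cstar_algebra"
  assumes hom: "unital_star_hom \<Phi>"
  shows "norm (\<Phi> x) \<le> norm x"
proof -
  note \<Phi> = unital_star_homD[OF hom]
  have unit: "norm (\<Phi> h) \<le> 1" if h: "star h = h" "norm h < 1" for h
  proof -
    obtain v where v: "isometry v" "h = (1/2) *\<^sub>R (v + star v)"
      using obtain_unitary_real_part[OF h] .
    have "isometry (\<Phi> v)"
      using v(1) \<Phi> by (metis isometry_def)
    then have n: "norm (\<Phi> v) = 1" by (rule norm_isometry)
    have "norm (\<Phi> h) = norm (\<Phi> v + star (\<Phi> v)) / 2"
      by (simp add: v(2) \<Phi>)
    also have "\<dots> \<le> 1"
      using norm_triangle_ineq[of "\<Phi> v" "star (\<Phi> v)"] by (simp add: norm_star n)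
    finally show ?thesis .
  qed
  have sa: "norm (\<Phi> h) \<le> norm h" if h: "star h = h" for h
  proof (rule dense_ge)
    fix r assume r: "norm h < r"
    then have r0: "0 < r" by (rule le_less_trans[OF norm_ge_zero])
    have "norm (\<Phi> ((1 / r) *\<^sub>R h)) \<le> 1"
      by (rule unit) (use r r0 in \<open>simp_all add: star_scaleR h\<close>)
    then show "norm (\<Phi> h) \<le> r" using r0 by (simp add: \<Phi>)
  qed
  have "norm (\<Phi> (star x * x)) \<le> norm (star x * x)"
    by (rule sa) (simp add: star_mult star_star)
  then have "(norm (\<Phi> x))\<^sup>2 \<le> (norm x)\<^sup>2"
    by (simp add: \<Phi> cstar_identity)
  then show ?thesis by (rule power2_le_imp_le) simp
qed

section \<open>Limits of ergodic averages\<close>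

lemma ergodic_average_tendsto_E1:
  assumes "uniquely_ergodic_fixed \<Phi>"
  shows "(\<lambda>n. ergodic_average \<Phi> n a) \<longlonglongrightarrow> E1 \<Phi> a"
  using assms by (simp add: uniquely_ergodic_fixed_def E1_def convergent_LIMSEQ_iff)

text \<open>
  The averages of a contraction are contractions and fix the fixed points, and both properties
  pass to the limit. That the limit is itself a fixed point comes from the telescoping
  \<open>\<Psi> (A\<^sub>n x) - A\<^sub>n x = (\<Psi>\<^sup>n x - x) / n\<close>, whose norm is at most \<open>2 * norm x / n\<close>. The
  nonzero fixed point rules out the zero projection.
\<close>
lemma norm_one_projection_onto_E1:
  fixes \<Psi> :: "'a::unital_cstar_algebra \<Rightarrow> 'a"
  assumes lin: "Vector_Spaces.linear scaleC scaleC \<Psi>"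
    and contr: "\<And>x. norm (\<Psi> x) \<le> norm x"
    and erg: "uniquely_ergodic_fixed \<Psi>"
    and a: "\<Psi> a = a" "a \<noteq> 0"
  shows "norm_one_projection_onto {x. \<Psi> x = x} (E1 \<Psi>)"
proof -
  let ?A = "ergodic_average \<Psi>"
  note lim = ergodic_average_tendsto_E1[OF erg]
  have add: "\<Psi> (x + y) = \<Psi> x + \<Psi> y" and scale: "\<Psi> (c *\<^sub>C x) = c *\<^sub>C \<Psi> x" for x y c
    using lin by (simp_all add: Vector_Spaces.linear_iff)
  have bl: "bounded_linear \<Psi>"
    by (rule bounded_linear_intro[where K = 1]) (simp_all add: add scale scaleR_scaleC contr)
  have pow_add: "(\<Psi> ^^ k) (x + y) = (\<Psi> ^^ k) x + (\<Psi> ^^ k) y" for k x y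
    by (induction k) (simp_all add: add)
  have pow_scale: "(\<Psi> ^^ k) (c *\<^sub>C x) = c *\<^sub>C (\<Psi> ^^ k) x" for k c x
    by (induction k) (simp_all add: scale)
  have pow_norm: "norm ((\<Psi> ^^ k) x) \<le> norm x" for k x
    by (induction k) (auto intro: order_trans[OF contr])
  have A_add: "?A n (x + y) = ?A n x + ?A n y" for n x y
    by (simp add: ergodic_average_def pow_add sum.distrib scaleR_add_right)
  have A_scale: "?A n (c *\<^sub>C x) = c *\<^sub>C ?A n x" for n c x
    by (simp add: ergodic_average_def pow_scale scaleR_scaleC scaleC_scaleC mult.commute
        flip: scaleC.scale_sum_right)
  have A_norm: "norm (?A n x) \<le> norm x" for n x
  proof (cases "n = 0")
    case False
    have "norm (\<Sum>k<n. (\<Psi> ^^ k) x) \<le> real n * norm x"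
      using sum_norm_bound[of "{..<n}" "\<lambda>k. (\<Psi> ^^ k) x" "norm x"] pow_norm by simp
    then show ?thesis using False by (simp add: ergodic_average_def field_simps)
  qed (simp add: ergodic_average_def)
  have E_add: "E1 \<Psi> (x + y) = E1 \<Psi> x + E1 \<Psi> y" for x y
    using tendsto_add[OF lim[of x] lim[of y]] lim[of "x + y"]
    by (auto simp: A_add intro: LIMSEQ_unique)
  have E_scale: "E1 \<Psi> (c *\<^sub>C x) = c *\<^sub>C E1 \<Psi> x" for c x
    using bounded_linear.tendsto[OF bounded_linear_scaleC lim[of x], of c] lim[of "c *\<^sub>C x"]
    by (auto simp: A_scale intro: LIMSEQ_unique)
  have E_norm: "norm (E1 \<Psi> x) \<le> norm x" for x
    by (rule LIMSEQ_le_const2[OF tendsto_norm[OF lim]]) (use A_norm in blast)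
  have E_fixed: "E1 \<Psi> x = x" if x: "\<Psi> x = x" for x
  proof -
    have "(\<Psi> ^^ k) x = x" for k
      by (induction k) (simp_all add: x)
    then have "?A n x = x" if "n \<ge> 1" for n
      using that by (simp add: ergodic_average_def sum_constant_scaleR del: sum_constant)
    then have "(\<lambda>n. ?A n x) \<longlonglongrightarrow> x"
      by (intro tendsto_eventually eventually_sequentiallyI[of 1])
    then show ?thesis using lim LIMSEQ_unique by blast
  qed
  have fixed_E: "\<Psi> (E1 \<Psi> x) = E1 \<Psi> x" for x
  proof -
    have "\<Psi> (?A n x) - ?A n x = (1 / real n) *\<^sub>R ((\<Psi> ^^ n) x - x)" for n
    proof -
      have "\<Psi> (?A n x) - ?A n x = (1 / real n) *\<^sub>R (\<Sum>k<n. (\<Psi> ^^ Suc k) x - (\<Psi> ^^ k) x)"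
        by (simp add: ergodic_average_def bounded_linear.linear[OF bl] linear_scale linear_sum
            sum_subtractf scaleR_diff_right)
      also have "(\<Sum>k<n. (\<Psi> ^^ Suc k) x - (\<Psi> ^^ k) x) = (\<Psi> ^^ n) x - x"
        by (subst sum_lessThan_telescope) simp
      finally show ?thesis .
    qed
    moreover have "norm ((\<Psi> ^^ n) x - x) \<le> 2 * norm x" for n
      using norm_triangle_ineq4[of "(\<Psi> ^^ n) x" x] pow_norm[of n x] by linarith
    ultimately have "norm (\<Psi> (?A n x) - ?A n x) \<le> 2 * norm x / real n" for n
      by (simp add: divide_inverse_commute) (rule mult_left_mono, auto)
    then have "(\<lambda>n. \<Psi> (?A n x) - ?A n x) \<longlonglongrightarrow> 0"
      by (intro Lim_null_comparison[OF always_eventually lim_const_over_n] allI)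
    moreover have "(\<lambda>n. \<Psi> (?A n x) - ?A n x) \<longlonglongrightarrow> \<Psi> (E1 \<Psi> x) - E1 \<Psi> x"
      by (intro tendsto_diff bounded_linear.tendsto[OF bl] lim)
    ultimately have "0 = \<Psi> (E1 \<Psi> x) - E1 \<Psi> x"
      by (rule LIMSEQ_unique)
    then show ?thesis by simp
  qed
  have blE: "bounded_linear (E1 \<Psi>)"
    by (rule bounded_linear_intro[where K = 1])
      (simp_all add: E_add E_scale scaleR_scaleC E_norm)
  have "onorm (E1 \<Psi>) = 1"
  proof (rule antisym)
    show "onorm (E1 \<Psi>) \<le> 1" by (rule onorm_bound) (simp_all add: E_norm)
    show "1 \<le> onorm (E1 \<Psi>)"
      using le_onorm[OF blE, of a] a by (simp add: E_fixed)
  qed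
  moreover have "Vector_Spaces.linear scaleC scaleC (E1 \<Psi>)"
    by (simp add: Vector_Spaces.linear_iff E_add E_scale scaleC.vector_space_axioms)
  moreover have "range (E1 \<Psi>) = {x. \<Psi> x = x}"
    using fixed_E E_fixed by (auto intro: range_eqI[OF sym])
  moreover have "E1 \<Psi> \<circ> E1 \<Psi> = E1 \<Psi>"
    by (simp add: fun_eq_iff E_fixed fixed_E)
  ultimately show ?thesis
    using blE by (simp add: norm_one_projection_onto_def)
qed

section \<open>Averages rotated by a peripheral eigenvalue\<close>

definition rotated :: "complex \<Rightarrow> ('a::unital_cstar_algebra \<Rightarrow> 'a) \<Rightarrow> 'a \<Rightarrow> 'a" where
  "rotated \<mu> \<Phi> x = cnj \<mu> *\<^sub>C \<Phi> x"

lemma mult_cnj_unit_circle: "cmod \<mu> = 1 \<Longrightarrow> cnj \<mu> * \<mu> = 1" "cmod \<mu> = 1 \<Longrightarrow> \<mu> * cnj \<mu> = 1"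
  by (simp_all add: complex_norm_square[symmetric] mult.commute)

lemma rotated_fixed_points:
  assumes "cmod \<mu> = 1"
  shows "{x. rotated \<mu> \<Phi> x = x} = eigenspace \<Phi> \<mu>"
  using mult_cnj_unit_circle[OF assms]
  by (auto simp: rotated_def eigenspace_def scaleC_scaleC scaleC_one)
    (metis scaleC_one scaleC_scaleC)

lemma rotated_funpow:
  assumes "unital_star_hom \<Phi>"
  shows "(rotated \<mu> \<Phi> ^^ k) x = cnj \<mu> ^ k *\<^sub>C (\<Phi> ^^ k) x"
  by (induction k)
    (simp_all add: scaleC_one rotated_def unital_star_homD[OF assms] scaleC_scaleC mult.commute)

lemma ergodic_average_rotated:
  assumes "unital_star_hom \<Phi>" "cmod \<mu> = 1"
  shows "ergodic_average (rotated \<mu> \<Phi>) n x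
    = (1 / real n) *\<^sub>R (\<Sum>k<n. (\<mu> powi (- int k)) *\<^sub>C (\<Phi> ^^ k) x)"
proof -
  have "inverse \<mu> = cnj \<mu>"
    by (rule inverse_unique) (rule mult_cnj_unit_circle(2)[OF assms(2)])
  then have "\<mu> powi (- int k) = cnj \<mu> ^ k" for k
    by (simp add: power_int_minus flip: power_inverse)
  then show ?thesis
    by (simp add: ergodic_average_def rotated_funpow[OF assms(1)])
qed

lemma funpow_mult_star_hom:
  fixes \<Phi> :: "'a::unital_cstar_algebra \<Rightarrow> 'a"
  assumes "unital_star_hom \<Phi>"
  shows "(\<Phi> ^^ k) (x * y) = (\<Phi> ^^ k) x * (\<Phi> ^^ k) y"
  by (induction k) (simp_all add: unital_star_homD[OF assms])

lemma funpow_star_eigenvector: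
  assumes "unital_star_hom \<Phi>" "u \<in> eigenspace \<Phi> \<mu>"
  shows "(\<Phi> ^^ k) (star u) = cnj \<mu> ^ k *\<^sub>C star u"
  using assms(2)
  by (induction k)
    (simp_all add: scaleC_one unital_star_homD[OF assms(1)] eigenspace_def star_scaleC
      scaleC_scaleC mult.commute)

text \<open>
  Right multiplication by \<open>star u\<close> turns \<open>\<Phi>\<close> into \<open>rotated \<mu> \<Phi>\<close> up to the factor \<open>star u\<close>, which the
  final \<open>u\<close> cancels.
\<close>
lemma ergodic_average_rotated_isometry:
  assumes "unital_star_hom \<Phi>" "u \<in> eigenspace \<Phi> \<mu>" "isometry u"
  shows "ergodic_average (rotated \<mu> \<Phi>) n x = ergodic_average \<Phi> n (x * star u) * u"
proof -
  have "(\<Phi> ^^ k) (x * star u) * u = (rotated \<mu> \<Phi> ^^ k) x" for k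
    using assms(3)
    by (simp add: funpow_mult_star_hom[OF assms(1)] funpow_star_eigenvector[OF assms(1,2)]
        rotated_funpow[OF assms(1)] mult_scaleC_left mult_scaleC_right mult.assoc isometry_def)
  then show ?thesis by (simp add: ergodic_average_def sum_distrib_right)
qed

lemma ergodic_average_rotated_co_isometry:
  assumes "unital_star_hom \<Phi>" "u \<in> eigenspace \<Phi> \<mu>" "co_isometry u"
  shows "ergodic_average (rotated \<mu> \<Phi>) n x = u * ergodic_average \<Phi> n (star u * x)"
proof -
  have "u * (\<Phi> ^^ k) (star u * x) = (rotated \<mu> \<Phi> ^^ k) x" for k
    using assms(3)
    by (simp add: funpow_mult_star_hom[OF assms(1)] funpow_star_eigenvector[OF assms(1,2)]
        rotated_funpow[OF assms(1)] mult_scaleC_left mult_scaleC_right co_isometry_def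
        flip: mult.assoc)
  then show ?thesis by (simp add: ergodic_average_def sum_distrib_left)
qed

theorem theorem4p1:
  fixes \<Phi> :: "'a::unital_cstar_algebra \<Rightarrow> 'a" and \<mu> :: complex
  assumes "unital_star_hom \<Phi>"
    and "uniquely_ergodic_fixed \<Phi>"
    and "\<mu> \<in> peripheral_point_spectrum \<Phi>"
    and "\<exists>u \<in> eigenspace \<Phi> \<mu>. isometry u \<or> co_isometry u"
  shows "\<exists>!E :: 'a \<Rightarrow> 'a.
    (\<forall>u \<in> eigenspace \<Phi> \<mu>. isometry u \<longrightarrow> (\<forall>x. E x = E1 \<Phi> (x * star u) * u)) \<and>
    (\<forall>u \<in> eigenspace \<Phi> \<mu>. co_isometry u \<longrightarrow> (\<forall>x. E x = u * E1 \<Phi> (star u * x))) \<and>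
    norm_one_projection_onto (eigenspace \<Phi> \<mu>) E \<and>
    (\<forall>x. (\<lambda>n. (1 / real n) *\<^sub>R (\<Sum>k<n. (\<mu> powi (- int k)) *\<^sub>C (\<Phi> ^^ k) x)) \<longlonglongrightarrow> E x)"
proof -
  note hom = assms(1)
  have \<mu>: "cmod \<mu> = 1" using assms(3) by (simp add: peripheral_point_spectrum_def)
  let ?\<Psi> = "rotated \<mu> \<Phi>"
  note fixed = rotated_fixed_points[OF \<mu>, of \<Phi>]
  note lim_\<Phi> = ergodic_average_tendsto_E1[OF assms(2)]
  have iso: "(\<lambda>n. ergodic_average ?\<Psi> n x) \<longlonglongrightarrow> E1 \<Phi> (x * star u) * u"
    if "u \<in> eigenspace \<Phi> \<mu>" "isometry u" for u x
    unfolding ergodic_average_rotated_isometry[OF hom that]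
    by (intro tendsto_mult_right lim_\<Phi>)
  have co_iso: "(\<lambda>n. ergodic_average ?\<Psi> n x) \<longlonglongrightarrow> u * E1 \<Phi> (star u * x)"
    if "u \<in> eigenspace \<Phi> \<mu>" "co_isometry u" for u x
    unfolding ergodic_average_rotated_co_isometry[OF hom that]
    by (intro tendsto_mult_left lim_\<Phi>)
  have erg: "uniquely_ergodic_fixed ?\<Psi>"
    unfolding uniquely_ergodic_fixed_def using assms(4) iso co_iso convergentI by metis
  note lim = ergodic_average_tendsto_E1[OF erg]
  obtain a where a: "?\<Psi> a = a" "a \<noteq> 0"
    using assms(3) fixed by (auto simp: peripheral_point_spectrum_def eigenspace_def)
  have proj: "norm_one_projection_onto (eigenspace \<Phi> \<mu>) (E1 ?\<Psi>)"
    unfolding fixed[symmetric]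
  proof (rule norm_one_projection_onto_E1[OF _ _ erg a])
    show "Vector_Spaces.linear scaleC scaleC ?\<Psi>"
      by (simp add: Vector_Spaces.linear_iff rotated_def unital_star_homD[OF hom]
          scaleC_add_right scaleC_scaleC mult.commute scaleC.vector_space_axioms)
    show "norm (?\<Psi> x) \<le> norm x" for x
      by (simp add: rotated_def norm_scaleC \<mu> norm_star_hom_le[OF hom])
  qed
  show ?thesis
    unfolding ergodic_average_rotated[OF hom \<mu>, symmetric]
  proof (rule ex1I[of _ "E1 ?\<Psi>"])
    show "(\<forall>u \<in> eigenspace \<Phi> \<mu>. isometry u \<longrightarrow> (\<forall>x. E1 ?\<Psi> x = E1 \<Phi> (x * star u) * u)) \<and>
      (\<forall>u \<in> eigenspace \<Phi> \<mu>. co_isometry u \<longrightarrow> (\<forall>x. E1 ?\<Psi> x = u * E1 \<Phi> (star u * x))) \<and>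
      norm_one_projection_onto (eigenspace \<Phi> \<mu>) (E1 ?\<Psi>) \<and>
      (\<forall>x. (\<lambda>n. ergodic_average ?\<Psi> n x) \<longlonglongrightarrow> E1 ?\<Psi> x)"
      using iso co_iso proj lim LIMSEQ_unique by blast
  qed (use lim LIMSEQ_unique in blast)
qed

end
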